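(* Let $N\ge 1$ be an integer and let $\sigma_N(z)=\sum_{j=1}^N\left(1-\frac{j-1}{N}\right)z^j$ be the Fejér polynomial. Let $m=(N-1)/2$ if $N$ is odd and $m=(N-2)/2$ if $N$ is even. Let $\{\tilde\nu_j\}_{j=1}^{m}$ be the set of positive roots of the equation $U'_N(x)=0$, and let $\tilde\gamma_j=1-2\tilde\nu_j^2$ for $j=1,\ldots,m$. Then \[ \sigma'_N(z)=\prod_{j=1}^{(N-1)/2}\left[1+z^2+2z\tilde\gamma_j\right]\quad\text{if } N \text{ is odd}, \] \[ \sigma'_N(z)=(1+z)\prod_{j=1}^{(N-2)/2}\left[1+z^2+2z\tilde\gamma_j\right]\quad\text{if } N \text{ is even}. \]
   Context: $U_j$ denotes the Chebyshev polynomial of the second kind of degree $j$, defined by $U_j(\cos t)=\frac{\sin (j+1)t}{\sin t}$, so that $U_j(x)=2^jx^j+\ldots$; $U'_j$ denotes its derivative. Empty products equal $1$. *)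

theory Defs
  imports Complex_Main "HOL-Computational_Algebra.Polynomial"
begin

definition is_chebyshev_U :: "nat \<Rightarrow> real poly \<Rightarrow> bool" where
  "is_chebyshev_U n p \<longleftrightarrow>
     (\<forall>t. sin t \<noteq> 0 \<longrightarrow> poly p (cos t) = sin (real (n + 1) * t) / sin t)"

definition chebyshev_U :: "nat \<Rightarrow> real poly" where
  "chebyshev_U n = (THE p. is_chebyshev_U n p)"

lemma is_chebyshev_U_unique:
  assumes "is_chebyshev_U n p" "is_chebyshev_U n q"
  shows "p = q"
proof (rule ccontr)
  assume "p \<noteq> q"
  hence "finite {x. poly (p - q) x = 0}"
    by (intro poly_roots_finite) simp
  moreover have "{-1<..<1} \<subseteq> {x. poly (p - q) x = 0}"
  proof
    fix x :: real assume "x \<in> {-1<..<1}"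
    hence x: "-1 < x" "x < 1" by auto
    hence "0 < arccos x" "arccos x < pi" using arccos_lt_bounded by blast+
    hence "sin (arccos x) \<noteq> 0" using sin_gt_zero by fastforce
    hence "poly p (cos (arccos x)) = poly q (cos (arccos x))"
      using assms unfolding is_chebyshev_U_def by simp
    thus "x \<in> {x. poly (p - q) x = 0}" using x by simp
  qed
  ultimately have "finite {-1<..<(1::real)}" using finite_subset by blast
  moreover have "infinite {-1<..<(1::real)}" by (rule infinite_Ioo) simp
  ultimately show False by contradiction
qed

lemma is_chebyshev_U_0: "is_chebyshev_U 0 1"
  by (simp add: is_chebyshev_U_def)

lemma is_chebyshev_U_1: "is_chebyshev_U (Suc 0) [:0, 2:]"
  by (simp add: is_chebyshev_U_def sin_double)

lemma is_chebyshev_U_rec: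
  assumes "is_chebyshev_U n p" "is_chebyshev_U (Suc n) q"
  shows "is_chebyshev_U (Suc (Suc n)) ([:0, 2:] * q - p)"
  unfolding is_chebyshev_U_def
proof (intro allI impI)
  fix t :: real assume t: "sin t \<noteq> 0"
  have p: "poly p (cos t) = sin (real (n + 1) * t) / sin t"
    and q: "poly q (cos t) = sin (real (Suc n + 1) * t) / sin t"
    using assms t unfolding is_chebyshev_U_def by blast+
  define s where "s = real (Suc n + 1) * t"
  have e: "real (n + 1) * t = s - t" "real (Suc (Suc n) + 1) * t = s + t"
    by (simp_all add: s_def algebra_simps)
  have "sin (s + t) = 2 * cos t * sin s - sin (s - t)"
    by (simp add: sin_add sin_diff)
  thus "poly ([:0, 2:] * q - p) (cos t) = sin (real (Suc (Suc n) + 1) * t) / sin t"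
    using p q unfolding e s_def[symmetric] by (simp add: diff_divide_distrib)
qed

lemma is_chebyshev_U_exists: "\<exists>p. is_chebyshev_U n p"
proof -
  have "(\<exists>p. is_chebyshev_U n p) \<and> (\<exists>p. is_chebyshev_U (Suc n) p)"
  proof (induction n)
    case 0
    show ?case using is_chebyshev_U_0 is_chebyshev_U_1 by blast
  next
    case (Suc n)
    thus ?case using is_chebyshev_U_rec by blast
  qed
  thus ?thesis ..
qed

lemma chebyshev_U: "is_chebyshev_U n (chebyshev_U n)"
  unfolding chebyshev_U_def
  using is_chebyshev_U_exists is_chebyshev_U_unique by (metis theI)

definition fejer_poly :: "nat \<Rightarrow> complex poly" where
  "fejer_poly N = (\<Sum>j=1..N. monom (1 - (of_nat j - 1) / of_nat N) j)"

end

theory Submission imports Defs begin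

text \<open>
  For \<open>x = (w + 1/w)/2\<close> one has \<open>w\<^sup>N U\<^sub>N'(x) = 2 N w \<sigma>\<^sub>N'(w\<^sup>2)\<close>, so a symmetric pair of roots
  \<open>\<plusminus>\<nu>\<close> of \<open>U\<^sub>N'\<close> contributes \<open>4 w\<^sup>2 (x\<^sup>2 - \<nu>\<^sup>2) = 1 + z\<^sup>2 + 2 z (1 - 2 \<nu>\<^sup>2)\<close> with
  \<open>z = w\<^sup>2\<close>. By Rolle, \<open>U\<^sub>N'\<close> has \<open>N - 1\<close> distinct real roots; they are symmetric about
  \<open>0\<close>, so parity of \<open>N - 1\<close> determines whether \<open>0\<close> is a root and how many are positive.
  Real \<open>w > 0\<close> suffice, since both sides of the claim are polynomials in \<open>z\<close>.
\<close>

section \<open>Chebyshev recurrences, leading coefficient and parity\<close>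

lemma chebyshev_U_0: "chebyshev_U 0 = 1"
  using is_chebyshev_U_unique[OF chebyshev_U is_chebyshev_U_0] .

lemma chebyshev_U_1: "chebyshev_U (Suc 0) = [:0, 2:]"
  using is_chebyshev_U_unique[OF chebyshev_U is_chebyshev_U_1] .

lemma chebyshev_U_rec:
  "chebyshev_U (Suc (Suc n)) = [:0, 2:] * chebyshev_U (Suc n) - chebyshev_U n"
  using is_chebyshev_U_unique[OF chebyshev_U is_chebyshev_U_rec[OF chebyshev_U chebyshev_U]] .

lemma poly_pderiv_chebyshev_U_rec:
  "poly (pderiv (chebyshev_U (Suc (Suc n)))) x =
     2 * poly (chebyshev_U (Suc n)) x + 2 * x * poly (pderiv (chebyshev_U (Suc n))) x
     - poly (pderiv (chebyshev_U n)) x"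
  by (simp add: chebyshev_U_rec pderiv_diff pderiv_mult pderiv_pCons pderiv_smult algebra_simps)

text \<open>The factor \<open>[:0, 2:]\<close> in the recurrence doubles the top coefficient, and
  \<open>chebyshev_U n\<close> has too small a degree to disturb it.\<close>

lemma degree_coeff_chebyshev_U:
  "degree (chebyshev_U n) \<le> n \<and> coeff (chebyshev_U n) n = 2 ^ n"
proof (induction n rule: induct_nat_012)
  case (ge2 n)
  have "degree ([:0, 2:] * chebyshev_U (Suc n)) \<le> Suc (Suc n)"
    using degree_mult_le[of "[:0, 2:]" "chebyshev_U (Suc n)"] ge2 by simp
  moreover have "coeff (chebyshev_U n) (Suc (Suc n)) = 0"
    using ge2 by (intro coeff_eq_0) simp
  ultimately show ?case
    using ge2 by (auto simp: chebyshev_U_rec coeff_pCons intro!: degree_diff_le)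
qed (simp_all add: chebyshev_U_0 chebyshev_U_1)

text \<open>Both parities share one induction because the recurrence for the derivative involves
  \<open>chebyshev_U (Suc n)\<close> itself. The second one makes the roots of U_N' symmetric about
  0.\<close>

lemma chebyshev_U_parity:
  "poly (chebyshev_U n) (- x) = (- 1) ^ n * poly (chebyshev_U n) x \<and>
   poly (pderiv (chebyshev_U n)) (- x) = (- 1) ^ Suc n * poly (pderiv (chebyshev_U n)) x"
proof (induction n rule: induct_nat_012)
  case (ge2 n)
  show ?case
    unfolding poly_pderiv_chebyshev_U_rec using ge2
    by (simp add: chebyshev_U_rec algebra_simps)
qed (simp_all add: chebyshev_U_0 chebyshev_U_1 pderiv_pCons)

section \<open>Recurrences for the Fejer derivative\<close>

text \<open>This is n sigma_n'(z), cleared of the denominator n. The type is left general so that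
  real and complex values can be compared.\<close>

definition fejer_deriv_sum :: "nat \<Rightarrow> 'a::comm_ring_1 \<Rightarrow> 'a" where
  "fejer_deriv_sum n z = (\<Sum>j<n. of_nat (Suc j) * (of_nat n - of_nat j) * z ^ j)"

text \<open>Passing from n to n + 1 raises every weight n - j by one, and the new term j = n enters
  with weight 1.\<close>

lemma fejer_deriv_sum_Suc:
  "fejer_deriv_sum (Suc n) z = fejer_deriv_sum n z + (\<Sum>j<Suc n. of_nat (Suc j) * z ^ j)"
proof -
  have "fejer_deriv_sum (Suc n) z =
      (\<Sum>j<n. of_nat (Suc j) * (of_nat (Suc n) - of_nat j) * z ^ j) + of_nat (Suc n) * z ^ n"
    by (simp add: fejer_deriv_sum_def)
  also have "(\<Sum>j<n. of_nat (Suc j) * (of_nat (Suc n) - of_nat j) * z ^ j) =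
      fejer_deriv_sum n z + (\<Sum>j<n. of_nat (Suc j) * z ^ j)"
    unfolding fejer_deriv_sum_def sum.distrib[symmetric]
    by (intro sum.cong refl) (simp add: algebra_simps)
  finally show ?thesis
    by (simp add: algebra_simps)
qed

text \<open>Splitting j + 1 into 1 and j leaves a geometric sum and the shorter weighted sum shifted
  by one power of z.\<close>

lemma sum_Suc_times_power_rec:
  fixes z :: "'a::comm_ring_1"
  shows "(\<Sum>j<Suc n. of_nat (Suc j) * z ^ j) = (\<Sum>k<Suc n. z ^ k) + z * (\<Sum>j<n. of_nat (Suc j) * z ^ j)"
proof (induction n)
  case (Suc n)
  define S T where "S = (\<lambda>n. \<Sum>k<n. z ^ k)" and "T = (\<lambda>n. \<Sum>j<n. of_nat (Suc j) * z ^ j)"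
  have "S (Suc (Suc n)) = S (Suc n) + z ^ Suc n" "T (Suc n) = T n + of_nat (Suc n) * z ^ n"
    "T (Suc (Suc n)) = T (Suc n) + of_nat (Suc (Suc n)) * z ^ Suc n" "T (Suc n) = S (Suc n) + z * T n"
    using Suc by (simp_all add: S_def T_def)
  hence "T (Suc (Suc n)) = S (Suc (Suc n)) + z * T (Suc n)"
    by (simp add: algebra_simps)
  thus ?case
    unfolding S_def T_def .
qed simp

text \<open>This mirrors the recurrence for U_n': z + 1 takes the place of 2 x w, z that of w^2, and
  the geometric sum that of U_(n+1).\<close>

lemma fejer_deriv_sum_rec:
  "fejer_deriv_sum (Suc (Suc n)) z =
     (\<Sum>k<Suc (Suc n). z ^ k) + (z + 1) * fejer_deriv_sum (Suc n) z - z * fejer_deriv_sum n z"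
proof -
  have "fejer_deriv_sum (Suc (Suc n)) z = fejer_deriv_sum (Suc n) z +
      ((\<Sum>k<Suc (Suc n). z ^ k) + z * (\<Sum>j<Suc n. of_nat (Suc j) * z ^ j))"
    unfolding fejer_deriv_sum_Suc[of "Suc n"] sum_Suc_times_power_rec[where n = "Suc n"] ..
  \<comment> \<open>The weighted sum is a difference of consecutive values of
    \<open>fejer_deriv_sum\<close>, hence can be eliminated.\<close>
  also have "z * (\<Sum>j<Suc n. of_nat (Suc j) * z ^ j) =
      z * fejer_deriv_sum (Suc n) z - z * fejer_deriv_sum n z"
    unfolding fejer_deriv_sum_Suc[of n] by (simp only: algebra_simps)
  finally show ?thesis
    by (simp add: algebra_simps)
qed

section \<open>The Joukowski substitution\<close>

text \<open>The hypothesis is x = (w + 1/w)/2 without division. After multiplication by w^n, U_n and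
  U_n' obey the recurrences of the geometric sum and of 2 w \<open>fejer_deriv_sum\<close> at w^2,
  with the same initial values.\<close>

lemma chebyshev_U_joukowski:
  fixes w x :: real
  assumes x: "2 * x * w = w\<^sup>2 + 1"
  shows "poly (chebyshev_U n) x * w ^ n = (\<Sum>k<Suc n. (w\<^sup>2) ^ k) \<and>
    poly (pderiv (chebyshev_U n)) x * w ^ n = 2 * w * fejer_deriv_sum n (w\<^sup>2)"
proof (induction n rule: induct_nat_012)
  case 0
  show ?case by (simp add: chebyshev_U_0 fejer_deriv_sum_def)
next
  case 1
  show ?case using x by (simp add: chebyshev_U_1 fejer_deriv_sum_def pderiv_pCons algebra_simps)
next
  case (ge2 n)
  define S where "S = (\<lambda>n. \<Sum>k<Suc n. (w\<^sup>2) ^ k)"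
  \<comment> \<open>Each difference of consecutive values of \<open>S\<close> is w^2 times the
    preceding one.\<close>
  have S: "S (Suc (Suc n)) = (w\<^sup>2 + 1) * S (Suc n) - w\<^sup>2 * S n"
    by (simp add: S_def algebra_simps)
  have U: "poly (chebyshev_U n) x * w ^ n = S n"
      "poly (chebyshev_U (Suc n)) x * w ^ Suc n = S (Suc n)"
    and U': "poly (pderiv (chebyshev_U n)) x * w ^ n = 2 * w * fejer_deriv_sum n (w\<^sup>2)"
      "poly (pderiv (chebyshev_U (Suc n))) x * w ^ Suc n = 2 * w * fejer_deriv_sum (Suc n) (w\<^sup>2)"
    using ge2 by (simp_all add: S_def)
  have "poly (chebyshev_U (Suc (Suc n))) x * w ^ Suc (Suc n) =
      (2 * x * w) * (poly (chebyshev_U (Suc n)) x * w ^ Suc n)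
      - w\<^sup>2 * (poly (chebyshev_U n) x * w ^ n)"
    by (simp add: chebyshev_U_rec algebra_simps power2_eq_square)
  also have "\<dots> = S (Suc (Suc n))"
    unfolding U x S ..
  finally have 1: "poly (chebyshev_U (Suc (Suc n))) x * w ^ Suc (Suc n) = S (Suc (Suc n))" .
  have "poly (pderiv (chebyshev_U (Suc (Suc n)))) x * w ^ Suc (Suc n) =
      2 * w * (poly (chebyshev_U (Suc n)) x * w ^ Suc n)
      + (2 * x * w) * (poly (pderiv (chebyshev_U (Suc n))) x * w ^ Suc n)
      - w\<^sup>2 * (poly (pderiv (chebyshev_U n)) x * w ^ n)"
    unfolding poly_pderiv_chebyshev_U_rec by (simp add: algebra_simps power2_eq_square)
  also have "\<dots> = 2 * w * fejer_deriv_sum (Suc (Suc n)) (w\<^sup>2)"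
    unfolding U U' x fejer_deriv_sum_rec S_def by (simp only: algebra_simps)
  finally show ?case
    using 1 by (simp add: S_def)
qed

lemma poly_pderiv_fejer_poly:
  assumes "N \<ge> 1"
  shows "of_nat N * poly (pderiv (fejer_poly N)) z = fejer_deriv_sum N z"
proof -
  have "poly (pderiv (fejer_poly N)) z =
      (\<Sum>j=1..N. of_nat j * (1 - (of_nat j - 1) / of_nat N) * z ^ (j - 1))"
    by (simp add: fejer_poly_def higher_pderiv_sum[of 1, simplified] pderiv_monom poly_sum poly_monom)
  \<comment> \<open>The index shift absorbs the power lost to differentiation.\<close>
  also have "\<dots> = (\<Sum>j<N. of_nat (Suc j) * (1 - of_nat j / of_nat N) * z ^ j)"
    by (rule sum.reindex_bij_witness[of _ Suc "\<lambda>j. j - 1"]) auto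
  finally show ?thesis
    using assms by (auto simp: fejer_deriv_sum_def sum_distrib_left field_simps intro!: sum.cong)
qed

section \<open>Real roots of the derivative of U_N\<close>

text \<open>Rolle's theorem gives a root of the derivative in each of the n - 1 gaps between
  consecutive zeros. The zeros are listed in decreasing order to suit the nodes cos(k
  pi/(N+1)).\<close>

lemma card_roots_pderiv_ge:
  fixes p :: "real poly"
  assumes "\<And>k. 1 \<le> k \<Longrightarrow> k \<le> n \<Longrightarrow> poly p (c k) = 0"
    and "\<And>k. 1 \<le> k \<Longrightarrow> k < n \<Longrightarrow> c (Suc k) < c k"
    and "pderiv p \<noteq> 0"
  shows "n - 1 \<le> card {x. poly (pderiv p) x = 0}"
proof -
  have "\<exists>r. \<forall>k\<in>{1..<n}. c (Suc k) < r k \<and> r k < c k \<and> poly (pderiv p) (r k) = 0"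
  proof (intro bchoice ballI)
    fix k assume k: "k \<in> {1..<n}"
    then obtain x where "c (Suc k) < x" "x < c k"
      "poly p (c k) - poly p (c (Suc k)) = (c k - c (Suc k)) * poly (pderiv p) x"
      using poly_MVT[of "c (Suc k)" "c k" p] assms(2)[of k] by auto
    moreover from this have "poly (pderiv p) x = 0"
      using k assms(1)[of k] assms(1)[of "Suc k"] by simp
    ultimately show "\<exists>x. c (Suc k) < x \<and> x < c k \<and> poly (pderiv p) x = 0"
      by blast
  qed
  then obtain r where r: "\<And>k. k \<in> {1..<n} \<Longrightarrow>
      c (Suc k) < r k \<and> r k < c k \<and> poly (pderiv p) (r k) = 0"
    by blast
  have anti: "c l \<le> c k" if "1 \<le> k" "k \<le> l" "l \<le> n" for k l
    using that(2,3)
  proof (induction l rule: dec_induct)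
    case (step i)
    then show ?case using assms(2)[of i] that(1) by simp
  qed simp
  \<comment> \<open>The gaps are disjoint: r l < c l \<le> c (k+1) < r k.\<close>
  have "r l < r k" if "k \<in> {1..<n}" "l \<in> {1..<n}" "k < l" for k l
    using r[OF that(1)] r[OF that(2)] anti[of "Suc k" l] that by simp
  hence "inj_on r {1..<n}"
    by (intro linorder_inj_onI') (metis less_irrefl)
  hence "n - 1 = card (r ` {1..<n})"
    by (simp add: card_image)
  also have "\<dots> \<le> card {x. poly (pderiv p) x = 0}"
    using r assms(3) by (intro card_mono poly_roots_finite) auto
  finally show ?thesis .
qed

text \<open>The n distinct roots exhaust the degree, so \<open>p\<close> and the scaled product of
  linear factors agree in the coefficient at n and at n points; their difference has degree below n
  and must vanish.\<close>

lemma poly_eq_prod_roots: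
  fixes p :: "'a::idom poly"
  assumes "degree p \<le> n" and "n \<le> card {x. poly p x = 0}"
    and "p \<noteq> 0"
  shows "poly p x = coeff p n * (\<Prod>r\<in>{x. poly p x = 0}. x - r)"
proof -
  let ?R = "{x. poly p x = 0}"
  let ?q = "\<Prod>r\<in>?R. [:- r, 1:]"
  have fin: "finite ?R"
    using assms(3) by (rule poly_roots_finite)
  have card: "card ?R = n"
    using card_poly_roots_bound[OF assms(3)] assms by simp
  have deg: "degree ?q = n"
    by (subst degree_prod_eq_sum_degree) (simp_all add: card)
  have "coeff ?q n = 1"
    using lead_coeff_prod[of "\<lambda>r. [:- r, 1:]" ?R] deg by simp
  hence "p = smult (coeff p n) ?q"
    using deg assms fin
    by (intro poly_eqI_degree_lead_coeff[of _ n _ ?R]) (auto simp: poly_prod intro: prod_zero)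
  hence "poly p x = poly (smult (coeff p n) ?q) x"
    by simp
  thus ?thesis
    by (simp add: poly_prod)
qed

text \<open>The angle lies strictly between 0 and pi, so the defining quotient applies, and its
  numerator is sin(k pi) = 0.\<close>

lemma poly_chebyshev_U_root:
  assumes "1 \<le> k" "k \<le> N"
  shows "poly (chebyshev_U N) (cos (real k * pi / real (N + 1))) = 0"
proof -
  let ?t = "real k * pi / real (N + 1)"
  have "real k * pi < pi * real (N + 1)"
    using assms by (simp add: mult.commute)
  hence "0 < ?t" "?t < pi"
    using assms by (simp_all add: pos_divide_less_eq del: of_nat_add)
  hence "sin ?t \<noteq> 0"
    using sin_gt_zero by fastforce
  hence "poly (chebyshev_U N) (cos ?t) = sin (real (N + 1) * ?t) / sin ?t"
    using chebyshev_U unfolding is_chebyshev_U_def by blast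
  also have "real (N + 1) * ?t = real k * pi"
    by simp
  finally show ?thesis
    by simp
qed

lemma degree_pderiv_chebyshev_U: "degree (pderiv (chebyshev_U N)) \<le> N - 1"
  using degree_coeff_chebyshev_U[of N] by (auto simp: degree_pderiv intro: diff_le_mono)

lemma coeff_pderiv_chebyshev_U:
  assumes "N \<ge> 1"
  shows "coeff (pderiv (chebyshev_U N)) (N - 1) = real N * 2 ^ N"
  using degree_coeff_chebyshev_U[of N] assms by (simp add: coeff_pderiv)

lemma pderiv_chebyshev_U_nonzero:
  assumes "N \<ge> 1"
  shows "pderiv (chebyshev_U N) \<noteq> 0"
  using coeff_pderiv_chebyshev_U[OF assms] assms by auto

text \<open>The degree bounds the count from above; Rolle between the N zeros of U_N bounds it from
  below.\<close>

lemma card_roots_pderiv_chebyshev_U: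
  assumes "N \<ge> 1"
  shows "card {x. poly (pderiv (chebyshev_U N)) x = 0} = N - 1"
proof (rule antisym)
  show "card {x. poly (pderiv (chebyshev_U N)) x = 0} \<le> N - 1"
    using card_poly_roots_bound[OF pderiv_chebyshev_U_nonzero[OF assms]]
      degree_pderiv_chebyshev_U[of N] by linarith
  show "N - 1 \<le> card {x. poly (pderiv (chebyshev_U N)) x = 0}"
  proof (rule card_roots_pderiv_ge[where c = "\<lambda>k. cos (real k * pi / real (N + 1))"])
    fix k assume "1 \<le> k" "k < N"
    moreover from this have "real k * pi < pi * real (N + 1)" "real (Suc k) * pi \<le> pi * real (N + 1)"
      by (simp_all add: mult.commute del: of_nat_Suc)
    \<comment> \<open>Both angles lie in [0, pi], where the cosine decreases strictly.\<close>
    ultimately show "cos (real (Suc k) * pi / real (N + 1)) < cos (real k * pi / real (N + 1))"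
      by (intro cos_monotone_0_pi)
        (simp_all add: pos_divide_le_eq divide_strict_right_mono del: of_nat_add of_nat_Suc)
  qed (use poly_chebyshev_U_root pderiv_chebyshev_U_nonzero[OF assms] in auto)
qed

text \<open>By symmetry the roots are the positive ones, their negatives and possibly 0. So N - 1 is
  twice the number of positive roots plus 0 or 1, which settles both numbers.\<close>

lemma roots_pderiv_chebyshev_U:
  fixes N :: nat
  defines "P \<equiv> {x. 0 < x \<and> poly (pderiv (chebyshev_U N)) x = 0}"
  assumes "N \<ge> 1"
  shows "finite P" and "card P = (N - 1) div 2"
    and "{x. poly (pderiv (chebyshev_U N)) x = 0} =
      P \<union> (uminus ` P \<union> (if even N then {0} else {}))"
proof -
  let ?R = "{x. poly (pderiv (chebyshev_U N)) x = 0}"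
  have "finite ?R"
    using pderiv_chebyshev_U_nonzero[OF assms(2)] by (rule poly_roots_finite)
  thus fin: "finite P"
    by (rule rev_finite_subset) (auto simp: P_def)
  have sym: "- x \<in> ?R" if "x \<in> ?R" for x
    using that chebyshev_U_parity[of N x] by simp
  have R: "?R = P \<union> (uminus ` P \<union> (?R \<inter> {0}))"
  proof (intro equalityI subsetI)
    fix x assume x: "x \<in> ?R"
    show "x \<in> P \<union> (uminus ` P \<union> (?R \<inter> {0}))"
    proof (cases x "0 :: real" rule: linorder_cases)
      case less
      hence "x = - (- x)" "- x \<in> P"
        using sym[OF x] by (simp_all add: P_def)
      thus ?thesis by blast
    qed (use x in \<open>auto simp: P_def\<close>)
  next
    fix x assume "x \<in> P \<union> (uminus ` P \<union> (?R \<inter> {0}))"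
    thus "x \<in> ?R" using sym by (auto simp: P_def)
  qed
  have "card ?R = card P + (card (uminus ` P) + card (?R \<inter> {0}))"
  proof (subst R, subst card_Un_disjoint)
    show "card P + card (uminus ` P \<union> (?R \<inter> {0})) = card P + (card (uminus ` P) + card (?R \<inter> {0}))"
      using fin by (subst card_Un_disjoint) (auto simp: P_def)
  qed (use fin in \<open>auto simp: P_def\<close>)
  hence card: "N - 1 = 2 * card P + card (?R \<inter> {0})"
    using card_roots_pderiv_chebyshev_U[OF assms(2)] by (simp add: card_image)
  have "card (?R \<inter> {0}) \<le> card {0 :: real}"
    by (intro card_mono) auto
  hence le1: "card (?R \<inter> {0}) \<le> 1"
    by simp
  show "card P = (N - 1) div 2"
    using card le1 by linarith
  \<comment> \<open>The count of roots at 0 is at most 1 and has the parity of N - 1.\<close>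
  have "card (?R \<inter> {0}) = (if even N then 1 else 0)"
    using card le1 assms(2) by (auto elim!: evenE oddE) presburger+
  hence zero: "?R \<inter> {0} = (if even N then {0} else {})"
    by (cases "0 \<in> ?R") (auto split: if_splits)
  show "?R = P \<union> (uminus ` P \<union> (if even N then {0} else {}))"
    using R unfolding zero .
qed

section \<open>Factorization over the reals\<close>

text \<open>The roots r and -r combine to x^2 - r^2, a root at 0 contributes x, and N 2^N is the
  leading coefficient.\<close>

lemma poly_pderiv_chebyshev_U_factored:
  assumes "N \<ge> 1"
  shows "poly (pderiv (chebyshev_U N)) x = real N * 2 ^ N *
    (if even N then x else 1) *
    (\<Prod>r\<in>{x. 0 < x \<and> poly (pderiv (chebyshev_U N)) x = 0}. x\<^sup>2 - r\<^sup>2)"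
proof -
  let ?R = "{x. poly (pderiv (chebyshev_U N)) x = 0}"
  let ?P = "{x. 0 < x \<and> poly (pderiv (chebyshev_U N)) x = 0}"
  note roots = roots_pderiv_chebyshev_U[OF assms]
  have "(\<Prod>r\<in>?R. x - r) = (\<Prod>r\<in>?P. x - r) * ((\<Prod>r\<in>uminus ` ?P. x - r) *
      (\<Prod>r\<in>(if even N then {0} else {}). x - r))"
  proof (subst roots(3), subst prod.union_disjoint)
    show "(\<Prod>r\<in>?P. x - r) * (\<Prod>r\<in>uminus ` ?P \<union> (if even N then {0} else {}). x - r) =
      (\<Prod>r\<in>?P. x - r) * ((\<Prod>r\<in>uminus ` ?P. x - r) *
      (\<Prod>r\<in>(if even N then {0} else {}). x - r))"
      using roots(1) by (subst prod.union_disjoint) auto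
  qed (use roots(1) in auto)
  also have "(\<Prod>r\<in>uminus ` ?P. x - r) = (\<Prod>r\<in>?P. x + r)"
    by (subst prod.reindex) auto
  also have "(\<Prod>r\<in>(if even N then {0} else {}). x - r) = (if even N then x else 1)"
    by simp
  also have "(\<Prod>r\<in>?P. x - r) * ((\<Prod>r\<in>?P. x + r) * (if even N then x else 1)) =
      (if even N then x else 1) * (\<Prod>r\<in>?P. x\<^sup>2 - r\<^sup>2)"
    by (simp add: prod.distrib[symmetric] power2_eq_square algebra_simps)
  finally have prod: "(\<Prod>r\<in>?R. x - r) = (if even N then x else 1) * (\<Prod>r\<in>?P. x\<^sup>2 - r\<^sup>2)" .
  have "N - 1 \<le> card ?R"
    using card_roots_pderiv_chebyshev_U[OF assms] by simp
  note poly_eq_prod_roots[OF degree_pderiv_chebyshev_U this pderiv_chebyshev_U_nonzero[OF assms], of x]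
  thus ?thesis
    unfolding prod coeff_pderiv_chebyshev_U[OF assms] by (simp only: mult.assoc)
qed

lemma fejer_deriv_sum_factored:
  fixes z :: real
  assumes "N \<ge> 1" and "z > 0"
  shows "fejer_deriv_sum N z = real N * (if even N then 1 + z else 1) *
    (\<Prod>r\<in>{x. 0 < x \<and> poly (pderiv (chebyshev_U N)) x = 0}. 1 + z\<^sup>2 + 2 * z * (1 - 2 * r\<^sup>2))"
proof -
  let ?P = "{x. 0 < x \<and> poly (pderiv (chebyshev_U N)) x = 0}"
  \<comment> \<open>Positivity of z gives a real nonzero w with w^2 = z, and x is its image under
    the Joukowski map.\<close>
  define w where "w = sqrt z"
  define x where "x = (w\<^sup>2 + 1) / (2 * w)"
  have w: "w > 0" "w\<^sup>2 = z"
    using assms by (simp_all add: w_def)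
  hence x: "2 * x * w = w\<^sup>2 + 1"
    by (simp add: x_def)
  have "1 + z\<^sup>2 + 2 * z * (1 - 2 * r\<^sup>2) = (2 * w)\<^sup>2 * (x\<^sup>2 - r\<^sup>2)" for r
  proof -
    have "(2 * w)\<^sup>2 * (x\<^sup>2 - r\<^sup>2) = (2 * x * w)\<^sup>2 - 4 * w\<^sup>2 * r\<^sup>2"
      by (simp add: power_mult_distrib algebra_simps)
    thus ?thesis
      unfolding x w(2) by (simp add: power2_eq_square algebra_simps)
  qed
  hence "(\<Prod>r\<in>?P. 1 + z\<^sup>2 + 2 * z * (1 - 2 * r\<^sup>2)) =
      (2 * w) ^ (2 * ((N - 1) div 2)) * (\<Prod>r\<in>?P. x\<^sup>2 - r\<^sup>2)"
    by (simp add: prod.distrib roots_pderiv_chebyshev_U(2)[OF assms(1)] power_mult)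
  \<comment> \<open>The extra factor 2 w is the one in \<open>chebyshev_U_joukowski\<close>; for
    even N, 1 + z is 2 w x.\<close>
  hence "2 * w * ((if even N then 1 + z else 1) * (\<Prod>r\<in>?P. 1 + z\<^sup>2 + 2 * z * (1 - 2 * r\<^sup>2))) =
      2 * w * (if even N then 2 * w * x else 1) * (2 * w) ^ (2 * ((N - 1) div 2)) *
      (\<Prod>r\<in>?P. x\<^sup>2 - r\<^sup>2)"
    using x w(2) by (simp add: mult_ac add_ac)
  \<comment> \<open>Counting powers of 2 w: one in front, one more for even N, and two per positive
    root make N in total.\<close>
  also have "2 * w * (if even N then 2 * w * x else 1) * (2 * w) ^ (2 * ((N - 1) div 2)) =
      (2 * w) ^ N * (if even N then x else 1)"
  proof (cases "even N")
    case True
    then obtain l where "N = 2 * l" "l \<noteq> 0"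
      using assms(1) by (elim evenE) auto
    then obtain k where "N = Suc (Suc (2 * k))"
      by (cases l) auto
    thus ?thesis by simp
  next
    case False
    then obtain k where "N = Suc (2 * k)"
      by (elim oddE) simp
    thus ?thesis by simp
  qed
  finally have "2 * w * (real N * (if even N then 1 + z else 1) *
      (\<Prod>r\<in>?P. 1 + z\<^sup>2 + 2 * z * (1 - 2 * r\<^sup>2))) = poly (pderiv (chebyshev_U N)) x * w ^ N"
    unfolding poly_pderiv_chebyshev_U_factored[OF assms(1), of x]
    by (simp add: mult_ac power_mult_distrib)
  also have "\<dots> = 2 * w * fejer_deriv_sum N z"
    using chebyshev_U_joukowski[OF x, of N] w by simp
  finally show ?thesis
    using w(1) by simp
qed

section \<open>Extension to complex arguments\<close>

lemma of_real_fejer_deriv_sum: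
  "fejer_deriv_sum n (of_real z) = (of_real (fejer_deriv_sum n z) :: 'a::{comm_ring_1, real_algebra_1})"
  by (simp add: fejer_deriv_sum_def)

text \<open>A nonzero difference would have only finitely many roots, but there are infinitely many
  positive reals.\<close>

lemma poly_eqI_pos_reals:
  fixes p q :: "complex poly"
  assumes "\<And>x. x > 0 \<Longrightarrow> poly p (of_real x) = poly q (of_real x)"
  shows "p = q"
proof (rule ccontr)
  assume "p \<noteq> q"
  hence "finite {z. poly (p - q) z = 0}"
    by (intro poly_roots_finite) simp
  moreover have "complex_of_real ` {0<..} \<subseteq> {z. poly (p - q) z = 0}"
    using assms by auto
  ultimately have "finite (complex_of_real ` {0<..})"
    by (rule rev_finite_subset)
  hence "finite {0 :: real<..}"
    by (rule finite_imageD) (simp add: inj_on_def)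
  thus False
    using infinite_Ioi by blast
qed

lemma pderiv_fejer_poly_factored:
  assumes "N \<ge> 1"
  shows "poly (pderiv (fejer_poly N)) z = (if even N then 1 + z else 1) *
    (\<Prod>r\<in>{x. 0 < x \<and> poly (pderiv (chebyshev_U N)) x = 0}.
       1 + z\<^sup>2 + 2 * z * complex_of_real (1 - 2 * r\<^sup>2))"
proof -
  let ?P = "{x. 0 < x \<and> poly (pderiv (chebyshev_U N)) x = 0}"
  \<comment> \<open>Encoding the right-hand side as a polynomial allows the identity to be checked
    at positive reals only.\<close>
  define q where "q = (if even N then [:1, 1:] else 1) *
    (\<Prod>r\<in>?P. [:1, 2 * complex_of_real (1 - 2 * r\<^sup>2), 1:])"
  have q: "poly q z = (if even N then 1 + z else 1) *
      (\<Prod>r\<in>?P. 1 + z\<^sup>2 + 2 * z * complex_of_real (1 - 2 * r\<^sup>2))" for z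
    by (auto simp: q_def poly_prod power2_eq_square algebra_simps intro!: prod.cong)
  have "pderiv (fejer_poly N) = q"
  proof (rule poly_eqI_pos_reals)
    fix x :: real assume x: "x > 0"
    have "of_nat N * poly (pderiv (fejer_poly N)) (of_real x) =
        complex_of_real (fejer_deriv_sum N x)"
      using poly_pderiv_fejer_poly[OF assms] by (simp add: of_real_fejer_deriv_sum)
    also have "\<dots> = of_nat N * poly q (of_real x)"
      unfolding fejer_deriv_sum_factored[OF assms x] q by simp
    finally show "poly (pderiv (fejer_poly N)) (of_real x) = poly q (of_real x)"
      using assms by simp
  qed
  thus ?thesis
    using q by simp
qed

text \<open>The existence of an enumeration is asserted first so that the claim about all
  enumerations is not vacuous. Any bijection will do, as the product does not depend on the order of
  the roots.\<close>

theorem mainTheorem5: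
  fixes N m :: nat
  assumes "N \<ge> 1"
    and "m = (if odd N then (N - 1) div 2 else (N - 2) div 2)"
  shows "(\<exists>\<nu>. bij_betw \<nu> {1..m} {x::real. x > 0 \<and> poly (pderiv (chebyshev_U N)) x = 0}) \<and>
    (\<forall>(\<nu> :: nat \<Rightarrow> real) (\<gamma> :: nat \<Rightarrow> real).
      bij_betw \<nu> {1..m} {x::real. x > 0 \<and> poly (pderiv (chebyshev_U N)) x = 0} \<longrightarrow>
      (\<forall>j\<in>{1..m}. \<gamma> j = 1 - 2 * (\<nu> j)\<^sup>2) \<longrightarrow>
      (odd N \<longrightarrow> (\<forall>z::complex. poly (pderiv (fejer_poly N)) z =
         (\<Prod>j=1..(N - 1) div 2. 1 + z\<^sup>2 + 2 * z * complex_of_real (\<gamma> j)))) \<and>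
      (even N \<longrightarrow> (\<forall>z::complex. poly (pderiv (fejer_poly N)) z =
         (1 + z) * (\<Prod>j=1..(N - 2) div 2. 1 + z\<^sup>2 + 2 * z * complex_of_real (\<gamma> j)))))"
proof (intro conjI allI impI)
  let ?P = "{x::real. x > 0 \<and> poly (pderiv (chebyshev_U N)) x = 0}"
  \<comment> \<open>For even N \<ge> 2, (N - 2)/2 is (N - 1)/2 rounded down.\<close>
  have m: "m = (N - 1) div 2"
    using assms by (simp split: if_splits) presburger
  have "card ?P = card {1..m}"
    using roots_pderiv_chebyshev_U(2)[OF assms(1)] m by simp
  thus "\<exists>\<nu>. bij_betw \<nu> {1..m} ?P"
    using roots_pderiv_chebyshev_U(1)[OF assms(1)] by (metis finite_same_card_bij finite_atLeastAtMost)
  fix \<nu> \<gamma> :: "nat \<Rightarrow> real" and z :: complex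
  assume \<nu>: "bij_betw \<nu> {1..m} ?P" and \<gamma>: "\<forall>j\<in>{1..m}. \<gamma> j = 1 - 2 * (\<nu> j)\<^sup>2"
  have "(\<Prod>j=1..m. 1 + z\<^sup>2 + 2 * z * complex_of_real (\<gamma> j)) =
      (\<Prod>j=1..m. 1 + z\<^sup>2 + 2 * z * complex_of_real (1 - 2 * (\<nu> j)\<^sup>2))"
    using \<gamma> by (intro prod.cong) auto
  also have "\<dots> = (\<Prod>r\<in>?P. 1 + z\<^sup>2 + 2 * z * complex_of_real (1 - 2 * r\<^sup>2))"
    by (rule prod.reindex_bij_betw[OF \<nu>])
  finally have prod: "poly (pderiv (fejer_poly N)) z = (if even N then 1 + z else 1) *
      (\<Prod>j=1..m. 1 + z\<^sup>2 + 2 * z * complex_of_real (\<gamma> j))"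
    using pderiv_fejer_poly_factored[OF assms(1)] by simp
  show "poly (pderiv (fejer_poly N)) z =
      (\<Prod>j=1..(N - 1) div 2. 1 + z\<^sup>2 + 2 * z * complex_of_real (\<gamma> j))" if "odd N"
    using prod that assms(2) by simp
  show "poly (pderiv (fejer_poly N)) z =
      (1 + z) * (\<Prod>j=1..(N - 2) div 2. 1 + z\<^sup>2 + 2 * z * complex_of_real (\<gamma> j))" if "even N"
    using prod that assms(2) by simp
qed

end
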